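(* Consider the infinite-horizon linear-quadratic game with a countably infinite set of identical decision makers described in the context. Assume: (i) $(A,B)$ is stabilizable; (ii) the random variables $x_0^i$ $(i\in\mathbb{N})$, $w_t^i$ $(i\in\mathbb{N},t\in\mathbb{N}_0)$, $\xi_t$ $(t\in\mathbb{N}_0)$ are mutually independent and have finite second-order moments; (iii) each of the families $(x_0^i)_{i\in\mathbb{N}}$, $(w_t^i)_{i\in\mathbb{N},t\in\mathbb{N}_0}$, $(\xi_t)_{t\in\mathbb{N}_0}$ is iid. Then every SEBEU (subjective equilibrium under beliefs of exogenous uncertainty) in pure strategies $s\in\mathbb{S}$ is also a Nash equilibrium in pure strategies.
   Context: Notation. $\mathbb{N}=\{1,2,\dots\}$, $\mathbb{N}_0=\{0,1,\dots\}$, $[1,\bar N]=\{1,\dots,\bar N\}$; $|x|_Q^2=x'Qx$; $'$ is transpose; $\succ0$ means positive definite; $\mathcal{P}(\cdot)$ is the set of Borel probability measures. Game. The decision makers are DM$^i$, $i\in\mathbb{N}$, all with the same data. DM$^i$ has state $x_t^i\in\mathbb{R}^{n_x}$, control $u_t^i\in\mathbb{R}^{n_u}$, disturbance $w_t^i\in\mathbb{R}^{n_x}$, dynamics $$x_{t+1}^i=Ax_t^i+Bu_t^i+w_t^i,\qquad t\in\mathbb{N}_0,$$ (no direct dependence on the environment variables), stage cost $$c(x^i,u^i,y)=|x^i|_Q^2+|u^i|_R^2+2y'(Ku^i+Lx^i),\qquad Q\succ0,\ R\succ0,$$ and discount factor $\beta\in[0,1)$. The environment variables $y_t\in\mathbb{Y}=\mathbb{R}^{n_y}$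 are given by $$y_t=\limsup_{\bar N\to\infty}\frac1{\bar N}\sum_{j\in[1,\bar N]}(E^1u_t^j+E^2x_t^j)+\xi_t,$$ (limsup componentwise) where $\xi_t\in\mathbb{R}^{n_y}$ is a random disturbance and $E^1,E^2$ are constant matrices. Strategies. At time $t$ DM$^i$ has access to $(I_t^i,Y_{t-1})$, where $I_t^i=((x_k^i)_{0\le k\le t},(u_k^i)_{0\le k<t})$ and $Y_{t-1}=(y_k)_{0\le k<t}$. A pure strategy $s^i=(s_t^i)_{t\in\mathbb{N}_0}$ is a collection of measurable maps giving $u_t^i=s_t^i(I_t^i,Y_{t-1})$; $\mathbb{S}^i$ is the set of these, $\mathbb{S}=\prod_{i\in\mathbb{N}}\mathbb{S}^i$, and $s^{-i}$ denotes the strategies of all DMs other than DM$^i$. Subjective cost. For $s^i\in\mathbb{S}^i$ and a deterministic sequence $\bar Z=(\bar z_t)_{t\in\mathbb{N}_0}\in\mathbb{Y}^{\mathbb{N}_0}$, $J^i(s^i,\bar Z)=E[\sum_{t\in\mathbb{N}_0}\beta^tc(x_t^i,u_t^i,\bar z_t)]$, where $x_{t+1}^i=Ax_t^i+Bu_t^i+w_t^i$ and $u_t^i=s_t^i(I_t^i,(\bar z_k)_{0\le k<t})$. For $\zeta\in\mathcal{P}(\mathbb{Y}^{\mathbb{N}_0})$, $E^\zeta[J^i(s^i,\cdot)]$ is the expectation of $J^i(s^i,\cdot)$ when the sequence has law $\zeta$ (an exogenous sequence independent of all other primitive random variables). SEBEU. $s=(s^i)_{i\in\mathbb{N}}\in\mathbb{S}$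 is a subjective equilibrium under beliefs of exogenous uncertainty (SEBEU) in pure strategies if there exist beliefs $\zeta^i\in\mathcal{P}(\mathbb{Y}^{\mathbb{N}_0})$, $i\in\mathbb{N}$, with (i) $E^{\zeta^i}[J^i(s^i,\cdot)]\le E^{\zeta^i}[J^i(\tilde s^i,\cdot)]$ for all $i\in\mathbb{N}$, $\tilde s^i\in\mathbb{S}^i$; and (ii) $\zeta^i=\zeta_s$ for all $i\in\mathbb{N}$, where $\zeta_s$ is the law of $(y_t)_{t\in\mathbb{N}_0}$ generated endogenously when all DMs use $s$ (in particular the $y_t$ are almost surely finite). Nash equilibrium. With $\bar J^i(s^i,s^{-i})=E[\sum_{t\in\mathbb{N}_0}\beta^tc(x_t^i,u_t^i,y_t)]$, where $(y_t)$ is generated endogenously under the joint strategy $(s^i,s^{-i})$, $s\in\mathbb{S}$ is a Nash equilibrium in pure strategies if $\bar J^i(s^i,s^{-i})\le\bar J^i(\tilde s^i,s^{-i})$ for all $i\in\mathbb{N}$, $\tilde s^i\in\mathbb{S}^i$. Standing convention: the expected costs appearing above are well defined. *)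

theory Defs
  imports "HOL-Probability.Probability"
begin

definition positive_definite :: "real^'n^'n \<Rightarrow> bool" where
  "positive_definite P \<longleftrightarrow> transpose P = P \<and> (\<forall>v. v \<noteq> 0 \<longrightarrow> 0 < v \<bullet> (P *v v))"

text \<open>Discrete time: all complex eigenvalues lie in the open unit disc.\<close>

definition schur_stable :: "real^'n^'n \<Rightarrow> bool" where
  "schur_stable P \<longleftrightarrow>
     (\<forall>(\<mu>::complex) v. v \<noteq> 0 \<longrightarrow> map_matrix complex_of_real P *v v = \<mu> *s v \<longrightarrow> cmod \<mu> < 1)"

definition stabilizable :: "real^'n^'n \<Rightarrow> real^'m^'n \<Rightarrow> bool" where
  "stabilizable A B \<longleftrightarrow> (\<exists>F::real^'n^'m. schur_stable (A + B ** F))"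

text \<open>Costs can be \<open>+\<infinity>\<close> for some strategies, so expectations are taken in the extended reals, as
  \<open>E f\<^sup>+ - E f\<^sup>-\<close>. This is meaningful when at most one of the two parts is infinite.\<close>

definition ereal_expectation :: "'a measure \<Rightarrow> ('a \<Rightarrow> ereal) \<Rightarrow> ereal" where
  "ereal_expectation N f =
     enn2ereal (\<integral>\<^sup>+\<omega>. e2ennreal (f \<omega>) \<partial>N) - enn2ereal (\<integral>\<^sup>+\<omega>. e2ennreal (- f \<omega>) \<partial>N)"

definition has_ereal_expectation :: "'a measure \<Rightarrow> ('a \<Rightarrow> ereal) \<Rightarrow> bool" where
  "has_ereal_expectation N f \<longleftrightarrow> f \<in> borel_measurable N \<and>
     ((\<integral>\<^sup>+\<omega>. e2ennreal (f \<omega>) \<partial>N) < \<infinity> \<or> (\<integral>\<^sup>+\<omega>. e2ennreal (- f \<omega>) \<partial>N) < \<infinity>)"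

definition iid :: "'w measure \<Rightarrow> ('i \<Rightarrow> 'w \<Rightarrow> 'b::topological_space) \<Rightarrow> bool" where
  "iid M X \<longleftrightarrow> prob_space.indep_vars M (\<lambda>_. borel) X UNIV \<and>
     (\<forall>i j. distr M borel (X i) = distr M borel (X j))"

text \<open>Mutual independence of all primitive random variables. They take values in two different
  types, so it is expressed (as in the definition of \<open>indep_vars\<close>) through the sigma-algebras that
  the variables generate.\<close>

datatype primitive = Init nat | Dist nat nat | Noise nat

fun generated_events ::
  "'w measure \<Rightarrow> (nat \<Rightarrow> 'w \<Rightarrow> real^'x) \<Rightarrow> (nat \<Rightarrow> nat \<Rightarrow> 'w \<Rightarrow> real^'x) \<Rightarrow>
   (nat \<Rightarrow> 'w \<Rightarrow> real^'y) \<Rightarrow> primitive \<Rightarrow> 'w set set" where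
  "generated_events M x0 w \<xi> (Init i) = {x0 i -` S \<inter> space M |S. S \<in> sets borel}"
| "generated_events M x0 w \<xi> (Dist i t) = {w i t -` S \<inter> space M |S. S \<in> sets borel}"
| "generated_events M x0 w \<xi> (Noise t) = {\<xi> t -` S \<inter> space M |S. S \<in> sets borel}"

definition mutually_independent ::
  "'w measure \<Rightarrow> (nat \<Rightarrow> 'w \<Rightarrow> real^'x) \<Rightarrow> (nat \<Rightarrow> nat \<Rightarrow> 'w \<Rightarrow> real^'x) \<Rightarrow>
   (nat \<Rightarrow> 'w \<Rightarrow> real^'y) \<Rightarrow> bool" where
  "mutually_independent M x0 w \<xi> \<longleftrightarrow>
     (\<forall>i. x0 i \<in> borel_measurable M) \<and> (\<forall>i t. w i t \<in> borel_measurable M) \<and>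
     (\<forall>t. \<xi> t \<in> borel_measurable M) \<and>
     prob_space.indep_sets M (generated_events M x0 w \<xi>) UNIV"

definition finite_second_moment :: "'w measure \<Rightarrow> ('w \<Rightarrow> 'b::real_normed_vector) \<Rightarrow> bool" where
  "finite_second_moment M X \<longleftrightarrow> integrable M (\<lambda>\<omega>. (norm (X \<omega>))\<^sup>2)"

text \<open>The information at time \<open>t\<close> is \<open>(x\<^sub>0,\<dots>,x\<^sub>t)\<close>, \<open>(u\<^sub>0,\<dots>,u\<^bsub>t-1\<^esub>)\<close>, \<open>(y\<^sub>0,\<dots>,y\<^bsub>t-1\<^esub>)\<close>; each finite
  sequence is an extensional function on its index set.\<close>

type_synonym ('x, 'u, 'y) strategy =
  "nat \<Rightarrow> (nat \<Rightarrow> real^'x) \<times> (nat \<Rightarrow> real^'u) \<times> (nat \<Rightarrow> real^'y) \<Rightarrow> real^'u"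

definition strategies :: "('x::finite, 'u::finite, 'y::finite) strategy set" where
  "strategies = {\<sigma>. \<forall>t. \<sigma> t \<in>
     (\<Pi>\<^sub>M k\<in>{..t}. borel) \<Otimes>\<^sub>M (\<Pi>\<^sub>M k\<in>{..<t}. borel) \<Otimes>\<^sub>M (\<Pi>\<^sub>M k\<in>{..<t}. borel) \<rightarrow>\<^sub>M borel}"

text \<open>The decision makers are numbered \<open>0, 1, 2, \<dots>\<close> instead of \<open>1, 2, 3, \<dots>\<close>.\<close>

locale lq_game =
  fixes A :: "real^'x::finite^'x" and B :: "real^'u::finite^'x"
    and Q :: "real^'x^'x" and R :: "real^'u^'u"
    and K :: "real^'u^'y::finite" and L :: "real^'x^'y"
    and E1 :: "real^'u^'y" and E2 :: "real^'x^'y"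
    and \<beta> :: real
    and M :: "'w measure"
    and x0 :: "nat \<Rightarrow> 'w \<Rightarrow> real^'x"
    and w :: "nat \<Rightarrow> nat \<Rightarrow> 'w \<Rightarrow> real^'x"
    and \<xi> :: "nat \<Rightarrow> 'w \<Rightarrow> real^'y"
begin

definition stage_cost :: "real^'x \<Rightarrow> real^'u \<Rightarrow> real^'y \<Rightarrow> real" where
  "stage_cost x u y = x \<bullet> (Q *v x) + u \<bullet> (R *v u) + 2 * (y \<bullet> (K *v u + L *v x))"

text \<open>Path \<open>((x\<^sub>0,\<dots>,x\<^sub>t), (u\<^sub>0,\<dots>,u\<^bsub>t-1\<^esub>))\<close> of decision maker \<open>i\<close> with strategy \<open>\<sigma>\<close> when the environment
  variables are the sequence \<open>z\<close>; only \<open>z k\<close> with \<open>k < t\<close> matters.\<close>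

primrec history ::
  "nat \<Rightarrow> ('x, 'u, 'y) strategy \<Rightarrow> (nat \<Rightarrow> real^'y) \<Rightarrow> 'w \<Rightarrow> nat \<Rightarrow> (nat \<Rightarrow> real^'x) \<times> (nat \<Rightarrow> real^'u)" where
  "history i \<sigma> z \<omega> 0 = ((\<lambda>_. undefined)(0 := x0 i \<omega>), (\<lambda>_. undefined))"
| "history i \<sigma> z \<omega> (Suc t) =
     (let (X, U) = history i \<sigma> z \<omega> t; u = \<sigma> t (X, U, restrict z {..<t})
      in (X(Suc t := A *v X t + B *v u + w i t \<omega>), U(t := u)))"

definition state :: "nat \<Rightarrow> ('x, 'u, 'y) strategy \<Rightarrow> (nat \<Rightarrow> real^'y) \<Rightarrow> 'w \<Rightarrow> nat \<Rightarrow> real^'x" where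
  "state i \<sigma> z \<omega> t = fst (history i \<sigma> z \<omega> t) t"

definition control :: "nat \<Rightarrow> ('x, 'u, 'y) strategy \<Rightarrow> (nat \<Rightarrow> real^'y) \<Rightarrow> 'w \<Rightarrow> nat \<Rightarrow> real^'u" where
  "control i \<sigma> z \<omega> t =
     \<sigma> t (fst (history i \<sigma> z \<omega> t), snd (history i \<sigma> z \<omega> t), restrict z {..<t})"

lemma history_conv:
  "history i \<sigma> z \<omega> t = (restrict (state i \<sigma> z \<omega>) {..t}, restrict (control i \<sigma> z \<omega>) {..<t})"
proof (induction t)
  case 0
  show ?case by (auto simp: state_def restrict_def fun_eq_iff)
next
  case (Suc t)
  have "fst (history i \<sigma> z \<omega> (Suc t)) = (fst (history i \<sigma> z \<omega> t))(Suc t := state i \<sigma> z \<omega> (Suc t))"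
    by (simp add: state_def Let_def split_beta)
  moreover have "snd (history i \<sigma> z \<omega> (Suc t)) = (snd (history i \<sigma> z \<omega> t))(t := control i \<sigma> z \<omega> t)"
    by (simp add: control_def Let_def split_beta)
  ultimately show ?case
    unfolding Suc.IH by (intro prod_eqI) (auto simp: fun_eq_iff restrict_def)
qed

lemma state_0: "state i \<sigma> z \<omega> 0 = x0 i \<omega>"
  by (simp add: state_def)

lemma state_Suc:
  "state i \<sigma> z \<omega> (Suc t) = A *v state i \<sigma> z \<omega> t + B *v control i \<sigma> z \<omega> t + w i t \<omega>"
  by (simp add: state_def control_def Let_def split_beta)

lemma control_eq:
  "control i \<sigma> z \<omega> t = \<sigma> t (restrict (state i \<sigma> z \<omega>) {..t}, restrict (control i \<sigma> z \<omega>) {..<t}, restrict z {..<t})"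
  by (subst control_def) (simp add: history_conv)

lemma history_cong:
  assumes "\<And>k. k < t \<Longrightarrow> z k = z' k"
  shows "history i \<sigma> z \<omega> t = history i \<sigma> z' \<omega> t"
  using assms
proof (induction t)
  case 0
  show ?case by simp
next
  case (Suc t)
  have "restrict z {..<t} = restrict z' {..<t}"
    using Suc.prems by (auto simp: restrict_def fun_eq_iff)
  moreover have "history i \<sigma> z \<omega> t = history i \<sigma> z' \<omega> t"
    using Suc by simp
  ultimately show ?case by simp
qed

text \<open>\<open>j\<close>-th decision maker's contribution to the environment, and component \<open>k\<close> of the limsup of the
  averages, in the extended reals.\<close>

definition contribution ::
  "(nat \<Rightarrow> ('x, 'u, 'y) strategy) \<Rightarrow> (nat \<Rightarrow> real^'y) \<Rightarrow> 'w \<Rightarrow> nat \<Rightarrow> nat \<Rightarrow> real^'y" where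
  "contribution s z \<omega> t j = E1 *v control j (s j) z \<omega> t + E2 *v state j (s j) z \<omega> t"

definition aggregate ::
  "(nat \<Rightarrow> ('x, 'u, 'y) strategy) \<Rightarrow> (nat \<Rightarrow> real^'y) \<Rightarrow> 'w \<Rightarrow> nat \<Rightarrow> 'y \<Rightarrow> ereal" where
  "aggregate s z \<omega> t k = limsup (\<lambda>N. ereal ((1 / real N) * (\<Sum>j<N. contribution s z \<omega> t j $ k)))"

text \<open>Endogenous environment \<open>(y\<^sub>0,\<dots>,y\<^bsub>t-1\<^esub>)\<close> under the joint strategy \<open>s\<close>. An infinite limsup is
  mapped to \<open>0\<close> by \<open>real_of_ereal\<close>; the predicate \<open>env_finite\<close> below says that this has
  probability zero.\<close>

primrec env_history ::
  "(nat \<Rightarrow> ('x, 'u, 'y) strategy) \<Rightarrow> 'w \<Rightarrow> nat \<Rightarrow> nat \<Rightarrow> real^'y" where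
  "env_history s \<omega> 0 = (\<lambda>_. undefined)"
| "env_history s \<omega> (Suc t) = (env_history s \<omega> t)
     (t := (\<chi> k. real_of_ereal (aggregate s (env_history s \<omega> t) \<omega> t k)) + \<xi> t \<omega>)"

definition env :: "(nat \<Rightarrow> ('x, 'u, 'y) strategy) \<Rightarrow> 'w \<Rightarrow> nat \<Rightarrow> real^'y" where
  "env s \<omega> t = env_history s \<omega> (Suc t) t"

lemma env_history_conv: "env_history s \<omega> t = restrict (env s \<omega>) {..<t}"
  by (induction t) (auto simp: env_def restrict_def fun_eq_iff less_Suc_eq)

lemma env_eq: "env s \<omega> t = (\<chi> k. real_of_ereal (aggregate s (env s \<omega>) \<omega> t k)) + \<xi> t \<omega>"
proof -
  have h: "history j (s j) (restrict (env s \<omega>) {..<t}) \<omega> t = history j (s j) (env s \<omega>) \<omega> t" for j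
    by (rule history_cong) simp
  have "contribution s (restrict (env s \<omega>) {..<t}) \<omega> t j = contribution s (env s \<omega>) \<omega> t j" for j
    by (simp add: contribution_def control_def state_def h)
  then have "aggregate s (env_history s \<omega> t) \<omega> t k = aggregate s (env s \<omega>) \<omega> t k" for k
    by (simp add: aggregate_def env_history_conv)
  then show ?thesis by (subst env_def) simp
qed

definition env_finite :: "(nat \<Rightarrow> ('x, 'u, 'y) strategy) \<Rightarrow> bool" where
  "env_finite s \<longleftrightarrow> (AE \<omega> in M. \<forall>t k. \<bar>aggregate s (env s \<omega>) \<omega> t k\<bar> \<noteq> \<infinity>)"

definition env_law :: "(nat \<Rightarrow> ('x, 'u, 'y) strategy) \<Rightarrow> (nat \<Rightarrow> real^'y) measure" where
  "env_law s = distr M borel (env s)"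

text \<open>The discounted cost is the limit of the partial sums in the extended reals.\<close>

definition discounted_stage_cost ::
  "nat \<Rightarrow> ('x, 'u, 'y) strategy \<Rightarrow> (nat \<Rightarrow> real^'y) \<Rightarrow> 'w \<Rightarrow> nat \<Rightarrow> ereal" where
  "discounted_stage_cost i \<sigma> z \<omega> t =
     ereal (\<beta> ^ t * stage_cost (state i \<sigma> z \<omega> t) (control i \<sigma> z \<omega> t) (z t))"

definition subjective_cost :: "nat \<Rightarrow> ('x, 'u, 'y) strategy \<Rightarrow> (nat \<Rightarrow> real^'y) \<Rightarrow> ereal" where
  "subjective_cost i \<sigma> z = ereal_expectation M (\<lambda>\<omega>. \<Sum>t. discounted_stage_cost i \<sigma> z \<omega> t)"

definition expected_subjective_cost ::
  "(nat \<Rightarrow> real^'y) measure \<Rightarrow> nat \<Rightarrow> ('x, 'u, 'y) strategy \<Rightarrow> ereal" where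
  "expected_subjective_cost \<zeta> i \<sigma> = ereal_expectation \<zeta> (subjective_cost i \<sigma>)"

definition objective_cost :: "nat \<Rightarrow> (nat \<Rightarrow> ('x, 'u, 'y) strategy) \<Rightarrow> ereal" where
  "objective_cost i s =
     ereal_expectation M (\<lambda>\<omega>. \<Sum>t. discounted_stage_cost i (s i) (env s \<omega>) \<omega> t)"

definition sebeu :: "(nat \<Rightarrow> ('x, 'u, 'y) strategy) \<Rightarrow> bool" where
  "sebeu s \<longleftrightarrow> (\<forall>i. s i \<in> strategies) \<and>
     (\<exists>\<zeta> :: nat \<Rightarrow> (nat \<Rightarrow> real^'y) measure.
        (\<forall>i. prob_space (\<zeta> i) \<and> sets (\<zeta> i) = sets borel) \<and>
        (\<forall>i. \<forall>\<sigma>\<in>strategies.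
           expected_subjective_cost (\<zeta> i) i (s i) \<le> expected_subjective_cost (\<zeta> i) i \<sigma>) \<and>
        env_finite s \<and> (\<forall>i. \<zeta> i = env_law s))"

text \<open>Finiteness of the environment is part of the definition, since \<open>objective_cost\<close> is meaningless
  without it.\<close>

definition nash_equilibrium :: "(nat \<Rightarrow> ('x, 'u, 'y) strategy) \<Rightarrow> bool" where
  "nash_equilibrium s \<longleftrightarrow> (\<forall>i. s i \<in> strategies) \<and>
     (\<forall>i. \<forall>\<sigma>\<in>strategies. env_finite (s(i := \<sigma>)) \<and>
        objective_cost i s \<le> objective_cost i (s(i := \<sigma>)))"

text \<open>Well-definedness (possibly with infinite value) of the expected costs that are compared at \<open>s\<close>:
  the discounted sums converge almost surely in the extended reals, and each expectation has at
  most one infinite part. No integrability is required, because deviations of infinite cost are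
  admissible.\<close>

definition subjective_cost_well_defined ::
  "(nat \<Rightarrow> real^'y) measure \<Rightarrow> nat \<Rightarrow> ('x, 'u, 'y) strategy \<Rightarrow> bool" where
  "subjective_cost_well_defined \<zeta> i \<sigma> \<longleftrightarrow>
     (AE z in \<zeta>. (AE \<omega> in M. summable (discounted_stage_cost i \<sigma> z \<omega>)) \<and>
        has_ereal_expectation M (\<lambda>\<omega>. \<Sum>t. discounted_stage_cost i \<sigma> z \<omega> t)) \<and>
     has_ereal_expectation \<zeta> (subjective_cost i \<sigma>)"

definition objective_cost_well_defined :: "nat \<Rightarrow> (nat \<Rightarrow> ('x, 'u, 'y) strategy) \<Rightarrow> bool" where
  "objective_cost_well_defined i s \<longleftrightarrow>
     (AE \<omega> in M. summable (discounted_stage_cost i (s i) (env s \<omega>) \<omega>)) \<and>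
     has_ereal_expectation M (\<lambda>\<omega>. \<Sum>t. discounted_stage_cost i (s i) (env s \<omega>) \<omega> t)"

definition costs_well_defined :: "(nat \<Rightarrow> ('x, 'u, 'y) strategy) \<Rightarrow> bool" where
  "costs_well_defined s \<longleftrightarrow> (\<forall>i. \<forall>\<sigma>\<in>strategies.
     subjective_cost_well_defined (env_law s) i \<sigma> \<and> objective_cost_well_defined i (s(i := \<sigma>)))"

end

end

theory Submission
  imports Defs
begin

text \<open>
  The environment variable is a limsup of averages over infinitely many decision makers, and changing
  one term of an average changes it by \<open>O(1/N)\<close>. Hence no single decision maker \<open>i\<close> influences the
  environment: the sequence \<open>y\<close> is, for every outcome, the same whether \<open>i\<close> plays \<open>s i\<close> or
  deviates (\<open>env_deviation\<close>). Removing the term of \<open>i\<close> from the averages also shows that \<open>y\<close> is a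
  function of the noise and of the primitive variables of the others, so that it is independent of the
  initial state and the disturbances of \<open>i\<close> (\<open>joint_law_env_own\<close>).

  For decision maker \<open>i\<close> the endogenous sequence \<open>y\<close> is therefore exogenous and independent of the
  randomness in the state equation of \<open>i\<close>. This is precisely the situation that the subjective cost
  describes with the belief \<open>env_law s\<close>, and Fubini's theorem identifies the objective cost of a
  deviation with its subjective cost (\<open>objective_eq_subjective\<close>). Optimality with respect to the
  belief is then optimality in the game.

  The costs are unbounded and may be infinite, so Fubini's theorem is needed for extended real
  expectations \<open>E f\<^sup>+ - E f\<^sup>-\<close> (\<open>ereal_expectation_iterated\<close>). One finite part of the
  joint expectation suffices, which is what the well-definedness of the objective cost provides.
\<close>

section \<open>Expectations in the extended reals\<close>

text \<open>Partial sums of terms of both signs can oscillate. Where they do, \<open>suminf\<close> is one fixed default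
  value; the set of convergence is measurable, so the value stays measurable across its boundary.\<close>

lemma borel_measurable_suminf_ereal:
  fixes f :: "nat \<Rightarrow> 'a \<Rightarrow> ereal"
  assumes [measurable]: "\<And>n. f n \<in> borel_measurable N"
  shows "(\<lambda>x. \<Sum>n. f n x) \<in> borel_measurable N"
  unfolding suminf_def sums_def[abs_def] lim_def[symmetric] by measurable

lemma ereal_expectation_distr:
  assumes [measurable]: "T \<in> N \<rightarrow>\<^sub>M N'" "f \<in> borel_measurable N'"
  shows "ereal_expectation (distr N N' T) f = ereal_expectation N (\<lambda>x. f (T x))"
  by (simp add: ereal_expectation_def nn_integral_distr)

text \<open>The positive part \<open>p - n\<close> and the negative part \<open>n - p\<close> of a difference are truncated
  differences; adding \<open>n\<close> to the first and \<open>p\<close> to the second makes them comparable.\<close>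

lemma ennreal_diff_add_cross:
  fixes p n :: ennreal
  assumes "p \<noteq> \<top> \<or> n \<noteq> \<top>"
  shows "(p - n) + n = p + (n - p)"
proof (cases "n \<le> p")
  case True
  then have "n - p = 0"
    using assms by (cases n; cases p) (auto simp: diff_eq_0_iff_ennreal top_unique)
  then show ?thesis
    using True by (simp add: diff_add_cancel_ennreal)
next
  case False
  then have "p - n = 0" and "p \<le> n"
    using assms by (cases n; cases p; auto simp: diff_eq_0_iff_ennreal top_unique)+
  then show ?thesis
    by (simp add: add.commute[of p] diff_add_cancel_ennreal)
qed

text \<open>Only \<open>p\<close> or \<open>n\<close> is known to be finite. If \<open>p\<close> is, so is \<open>a\<close>, and both differences are \<open>-\<infinity>\<close>
  when \<open>n\<close> is infinite; the other case is symmetric.\<close>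

lemma enn2ereal_diff_eqI:
  fixes a b p n :: ennreal
  assumes eq: "a + n = p + b" and le: "a \<le> p" "b \<le> n" and fin: "p \<noteq> \<top> \<or> n \<noteq> \<top>"
  shows "enn2ereal a - enn2ereal b = enn2ereal p - enn2ereal n"
proof (cases "p = \<top> \<or> n = \<top>")
  case True
  then consider "p = \<top>" "n \<noteq> \<top>" | "n = \<top>" "p \<noteq> \<top>"
    using fin by blast
  then show ?thesis
  proof cases
    case 1
    then have "a = \<top>" "b \<noteq> \<top>"
      using eq le by (auto simp: top_unique ennreal_add_eq_top)
    with 1 show ?thesis by (cases b; cases n) simp_all
  next
    case 2
    then have "p + b = \<top>"
      using eq by simp
    then have "b = \<top>" "a \<noteq> \<top>"
      using 2 le by (auto simp: top_unique ennreal_add_eq_top)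
    with 2 show ?thesis by (cases a; cases p) simp_all
  qed
next
  case False
  with le have "a \<noteq> \<top>" "b \<noteq> \<top>" by (auto simp: top_unique)
  with False eq show ?thesis
    by (cases a; cases b; cases p; cases n) (auto simp flip: ennreal_plus)
qed

text \<open>Where one part of \<open>f\<close> has a finite integral, almost every section has a finite part of the same
  sign. The identity between the four truncated parts, which holds for almost every section, can then
  be integrated without subtracting infinities.\<close>

lemma ereal_expectation_iterated:
  fixes f :: "'a \<times> 'b \<Rightarrow> ereal"
  assumes "sigma_finite_measure N"
    and f: "has_ereal_expectation (Z \<Otimes>\<^sub>M N) f"
  shows "ereal_expectation Z (\<lambda>z. ereal_expectation N (\<lambda>x. f (z, x))) = ereal_expectation (Z \<Otimes>\<^sub>M N) f"
proof -
  interpret sigma_finite_measure N by fact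
  have [measurable]: "f \<in> borel_measurable (Z \<Otimes>\<^sub>M N)"
    using f by (simp add: has_ereal_expectation_def)
  define p where "p z = (\<integral>\<^sup>+x. e2ennreal (f (z, x)) \<partial>N)" for z
  define n where "n z = (\<integral>\<^sup>+x. e2ennreal (- f (z, x)) \<partial>N)" for z
  have [measurable]: "p \<in> borel_measurable Z" "n \<in> borel_measurable Z"
    unfolding p_def n_def by measurable
  have P: "(\<integral>\<^sup>+x. e2ennreal (f x) \<partial>(Z \<Otimes>\<^sub>M N)) = (\<integral>\<^sup>+z. p z \<partial>Z)"
    unfolding p_def by (rule nn_integral_fst[symmetric]) simp
  have N: "(\<integral>\<^sup>+x. e2ennreal (- f x) \<partial>(Z \<Otimes>\<^sub>M N)) = (\<integral>\<^sup>+z. n z \<partial>Z)"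
    unfolding n_def by (rule nn_integral_fst[symmetric]) simp
  have fin: "(\<integral>\<^sup>+z. p z \<partial>Z) \<noteq> \<top> \<or> (\<integral>\<^sup>+z. n z \<partial>Z) \<noteq> \<top>"
    using f by (auto simp: has_ereal_expectation_def P N)
  then have "(AE z in Z. p z \<noteq> \<top>) \<or> (AE z in Z. n z \<noteq> \<top>)"
    using nn_integral_PInf_AE[of p Z] nn_integral_PInf_AE[of n Z] by (auto simp: infinity_ennreal_def)
  then have "AE z in Z. p z \<noteq> \<top> \<or> n z \<noteq> \<top>"
    by (auto elim!: eventually_mono)
  then have "AE z in Z. (p z - n z) + n z = p z + (n z - p z)"
    by eventually_elim (rule ennreal_diff_add_cross)
  then have "(\<integral>\<^sup>+z. (p z - n z) + n z \<partial>Z) = (\<integral>\<^sup>+z. p z + (n z - p z) \<partial>Z)"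
    by (rule nn_integral_cong_AE)
  then have sums: "(\<integral>\<^sup>+z. p z - n z \<partial>Z) + (\<integral>\<^sup>+z. n z \<partial>Z) = (\<integral>\<^sup>+z. p z \<partial>Z) + (\<integral>\<^sup>+z. n z - p z \<partial>Z)"
    by (simp add: nn_integral_add)
  have sect: "ereal_expectation N (\<lambda>x. f (z, x)) = enn2ereal (p z) - enn2ereal (n z)" for z
    by (simp add: ereal_expectation_def p_def n_def)
  have "e2ennreal (- (enn2ereal (p z) - enn2ereal (n z))) = n z - p z"
    if "p z \<noteq> \<top> \<or> n z \<noteq> \<top>" for z
  proof -
    have "- (enn2ereal (p z) - enn2ereal (n z)) = enn2ereal (n z) - enn2ereal (p z)"
      using that by (intro ereal_minus_diff_eq) auto
    then show ?thesis by simp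
  qed
  then have "AE z in Z. e2ennreal (- (enn2ereal (p z) - enn2ereal (n z))) = n z - p z"
    using \<open>AE z in Z. p z \<noteq> \<top> \<or> n z \<noteq> \<top>\<close> by (auto elim!: eventually_mono)
  then have "(\<integral>\<^sup>+z. e2ennreal (- (enn2ereal (p z) - enn2ereal (n z))) \<partial>Z) = (\<integral>\<^sup>+z. n z - p z \<partial>Z)"
    by (rule nn_integral_cong_AE)
  then have "ereal_expectation Z (\<lambda>z. ereal_expectation N (\<lambda>x. f (z, x))) =
      enn2ereal (\<integral>\<^sup>+z. p z - n z \<partial>Z) - enn2ereal (\<integral>\<^sup>+z. n z - p z \<partial>Z)"
    unfolding sect by (simp add: ereal_expectation_def)
  also have "\<dots> = enn2ereal (\<integral>\<^sup>+z. p z \<partial>Z) - enn2ereal (\<integral>\<^sup>+z. n z \<partial>Z)"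
    using sums fin by (intro enn2ereal_diff_eqI) (auto intro!: nn_integral_mono diff_le_self_ennreal)
  also have "\<dots> = ereal_expectation (Z \<Otimes>\<^sub>M N) f"
    by (simp add: ereal_expectation_def P N)
  finally show ?thesis .
qed

section \<open>Averages do not see a single term\<close>

text \<open>The averages differ by at most \<open>\<bar>a i - b i\<bar> / N\<close>, a null sequence, and adding a sequence with a
  finite limit commutes with an extended real limsup even where the latter is infinite.\<close>

lemma limsup_average_cong:
  fixes a b :: "nat \<Rightarrow> real"
  assumes "\<And>j. j \<noteq> i \<Longrightarrow> a j = b j"
  shows "limsup (\<lambda>N. ereal ((1 / real N) * (\<Sum>j<N. a j))) = limsup (\<lambda>N. ereal ((1 / real N) * (\<Sum>j<N. b j)))"
proof -
  have diff: "(\<Sum>j<N. a j) - (\<Sum>j<N. b j) = (if i < N then a i - b i else 0)" for N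
  proof -
    have "(\<Sum>j<N. a j) - (\<Sum>j<N. b j) = (\<Sum>j<N. if j = i then a i - b i else 0)"
      unfolding sum_subtractf[symmetric] using assms by (intro sum.cong) auto
    then show ?thesis by simp
  qed
  have "(\<lambda>N. (1 / real N) * (if i < N then a i - b i else 0)) \<longlonglongrightarrow> 0"
  proof (rule Lim_transform_eventually)
    show "(\<lambda>N. (1 / real N) * (a i - b i)) \<longlonglongrightarrow> 0"
      using tendsto_mult[OF lim_1_over_n tendsto_const[of "a i - b i"]] by simp
    show "\<forall>\<^sub>F N in sequentially. (1 / real N) * (a i - b i) = (1 / real N) * (if i < N then a i - b i else 0)"
      using eventually_gt_at_top[of i] by eventually_elim simp
  qed
  then have "(\<lambda>N. ereal ((1 / real N) * (if i < N then a i - b i else 0))) \<longlonglongrightarrow> 0"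
    by (simp add: zero_ereal_def)
  from ereal_limsup_lim_add[OF this, of "\<lambda>N. ereal ((1 / real N) * (\<Sum>j<N. b j))"]
  have "limsup (\<lambda>N. ereal ((1 / real N) * (if i < N then a i - b i else 0)) + ereal ((1 / real N) * (\<Sum>j<N. b j)))
      = limsup (\<lambda>N. ereal ((1 / real N) * (\<Sum>j<N. b j)))"
    by simp
  moreover have "ereal ((1 / real N) * (if i < N then a i - b i else 0)) + ereal ((1 / real N) * (\<Sum>j<N. b j))
      = ereal ((1 / real N) * (\<Sum>j<N. a j))" for N
    unfolding diff[symmetric] by (simp add: algebra_simps)
  ultimately show ?thesis by simp
qed

context lq_game
begin

lemma aggregate_deviation: "aggregate (s(i := \<sigma>)) z \<omega> t k = aggregate s z \<omega> t k"
  unfolding aggregate_def by (rule limsup_average_cong[of i]) (simp add: contribution_def)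

text \<open>The averages can be formed without the state and control of decision maker \<open>i\<close>; this is the form
  in which the environment is seen to be a function of the other primitive variables.\<close>

lemma aggregate_drop:
  "aggregate s z \<omega> t k =
     limsup (\<lambda>N. ereal ((1 / real N) * (\<Sum>j<N. if j = i then 0 else contribution s z \<omega> t j $ k)))"
  unfolding aggregate_def by (rule limsup_average_cong[of i]) simp

lemma env_deviation: "env (s(i := \<sigma>)) = env s"
proof -
  have hist: "env_history (s(i := \<sigma>)) \<omega> t = env_history s \<omega> t" for \<omega> t
    by (induction t) (simp_all add: aggregate_deviation del: fun_upd_apply)
  show ?thesis by (intro ext) (simp only: env_def hist)
qed

text \<open>Finiteness under a deviation, a part of the equilibrium property, is inherited from \<open>s\<close>.\<close>

lemma env_finite_deviation: "env_finite (s(i := \<sigma>)) \<longleftrightarrow> env_finite s"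
  by (simp add: env_finite_def env_deviation aggregate_deviation)

section \<open>Measurability\<close>

lemma borel_measurable_matrix_vector_mult [measurable (raw)]:
  fixes C :: "real^'m::finite^'n::finite"
  assumes "f \<in> borel_measurable N"
  shows "(\<lambda>x. C *v f x) \<in> borel_measurable N"
  by (rule measurable_compose[OF assms borel_measurable_continuous_onI])
     (rule matrix_vector_mult_linear_continuous_on)

text \<open>The measure \<open>N\<close> below is arbitrary: the sigma-algebra will be the one generated by the primitive
  variables of decision maker \<open>i\<close> alone, or the one generated by all the others.\<close>

lemma measurable_state_control:
  assumes \<sigma>: "\<sigma> \<in> strategies"
    and [measurable]: "x0 j \<in> borel_measurable N" "\<And>t. w j t \<in> borel_measurable N"
  shows measurable_state: "(\<lambda>(z, \<omega>). state j \<sigma> z \<omega> t) \<in> borel_measurable (borel \<Otimes>\<^sub>M N)"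
    and measurable_control: "(\<lambda>(z, \<omega>). control j \<sigma> z \<omega> t) \<in> borel_measurable (borel \<Otimes>\<^sub>M N)"
proof -
  let ?BN = "(borel :: (nat \<Rightarrow> real^'y) measure) \<Otimes>\<^sub>M N"
  have strat: "\<sigma> t \<in> (\<Pi>\<^sub>M k\<in>{..t}. borel) \<Otimes>\<^sub>M (\<Pi>\<^sub>M k\<in>{..<t}. borel) \<Otimes>\<^sub>M (\<Pi>\<^sub>M k\<in>{..<t}. borel) \<rightarrow>\<^sub>M borel" for t
    using \<sigma> by (simp add: strategies_def)
  have env_comp: "(\<lambda>x. fst x k) \<in> borel_measurable ?BN" for k :: nat
    by (rule measurable_compose[OF measurable_fst measurable_product_coordinates])
  have ctrl: "(\<lambda>x. control j \<sigma> (fst x) (snd x) t) \<in> borel_measurable ?BN"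
    if "\<And>k. k \<le> t \<Longrightarrow> (\<lambda>x. state j \<sigma> (fst x) (snd x) k) \<in> borel_measurable ?BN"
      and "\<And>k. k < t \<Longrightarrow> (\<lambda>x. control j \<sigma> (fst x) (snd x) k) \<in> borel_measurable ?BN" for t
  proof -
    have X: "(\<lambda>x. restrict (state j \<sigma> (fst x) (snd x)) {..t}) \<in> ?BN \<rightarrow>\<^sub>M (\<Pi>\<^sub>M k\<in>{..t}. borel)"
      using that(1) by (intro measurable_restrict) simp
    have U: "(\<lambda>x. restrict (control j \<sigma> (fst x) (snd x)) {..<t}) \<in> ?BN \<rightarrow>\<^sub>M (\<Pi>\<^sub>M k\<in>{..<t}. borel)"
      using that(2) by (intro measurable_restrict) simp
    have Y: "(\<lambda>x. restrict (fst x) {..<t}) \<in> ?BN \<rightarrow>\<^sub>M (\<Pi>\<^sub>M k\<in>{..<t}. borel)"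
      using env_comp by (intro measurable_restrict)
    have "(\<lambda>x. control j \<sigma> (fst x) (snd x) t) = (\<lambda>x. \<sigma> t (restrict (state j \<sigma> (fst x) (snd x)) {..t},
        restrict (control j \<sigma> (fst x) (snd x)) {..<t}, restrict (fst x) {..<t}))"
      by (rule ext) (rule control_eq)
    then show ?thesis
      using measurable_compose[OF measurable_Pair[OF X measurable_Pair[OF U Y]] strat] by (simp only:)
  qed
  have "(\<lambda>x. state j \<sigma> (fst x) (snd x) t) \<in> borel_measurable ?BN \<and>
        (\<lambda>x. control j \<sigma> (fst x) (snd x) t) \<in> borel_measurable ?BN" for t
  proof (induction t rule: less_induct)
    case (less t)
    have st: "(\<lambda>x. state j \<sigma> (fst x) (snd x) t) \<in> borel_measurable ?BN"
    proof (cases t)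
      case 0
      then show ?thesis by (simp add: state_0)
    next
      case (Suc r)
      then have "(\<lambda>x. state j \<sigma> (fst x) (snd x) r) \<in> borel_measurable ?BN"
          "(\<lambda>x. control j \<sigma> (fst x) (snd x) r) \<in> borel_measurable ?BN"
        using less by auto
      note [measurable] = this
      show ?thesis
        unfolding Suc state_Suc by measurable
    qed
    moreover have "(\<lambda>x. control j \<sigma> (fst x) (snd x) t) \<in> borel_measurable ?BN"
      by (rule ctrl) (use less st in \<open>auto simp: le_less\<close>)
    ultimately show ?case ..
  qed
  then show "(\<lambda>(z, \<omega>). state j \<sigma> z \<omega> t) \<in> borel_measurable ?BN"
    and "(\<lambda>(z, \<omega>). control j \<sigma> z \<omega> t) \<in> borel_measurable ?BN"
    by (simp_all add: split_beta')
qed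

lemma measurable_total_cost:
  assumes "\<sigma> \<in> strategies" "x0 i \<in> borel_measurable N" "\<And>t. w i t \<in> borel_measurable N"
  shows "(\<lambda>(z, \<omega>). \<Sum>t. discounted_stage_cost i \<sigma> z \<omega> t) \<in> borel_measurable (borel \<Otimes>\<^sub>M N)"
proof -
  note [measurable] = measurable_state_control[OF assms, unfolded split_beta']
  have [measurable]: "(\<lambda>x. fst x t) \<in> borel_measurable ((borel :: (nat \<Rightarrow> real^'y) measure) \<Otimes>\<^sub>M N)" for t
    by (rule measurable_compose[OF measurable_fst measurable_product_coordinates])
  show ?thesis
    unfolding split_beta' discounted_stage_cost_def stage_cost_def
    by (intro borel_measurable_suminf_ereal) measurable
qed

lemma measurable_env:
  assumes s: "\<And>j. s j \<in> strategies"
    and x0: "\<And>j. j \<noteq> i \<Longrightarrow> x0 j \<in> borel_measurable N"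
    and w: "\<And>j t. j \<noteq> i \<Longrightarrow> w j t \<in> borel_measurable N"
    and [measurable]: "\<And>t. \<xi> t \<in> borel_measurable N"
  shows "env s \<in> borel_measurable N"
proof -
  have hist: "(\<lambda>\<omega>. env_history s \<omega> t) \<in> borel_measurable N" for t
  proof (induction t)
    case 0
    show ?case by simp
  next
    case (Suc t)
    note [measurable] = Suc.IH
    have contr: "(\<lambda>\<omega>. contribution s (env_history s \<omega> t) \<omega> t j $ k) \<in> borel_measurable N"
      if "j \<noteq> i" for j k
    proof -
      have pair: "(\<lambda>\<omega>. (env_history s \<omega> t, \<omega>)) \<in> N \<rightarrow>\<^sub>M borel \<Otimes>\<^sub>M N"
        by measurable
      have [measurable]: "(\<lambda>\<omega>. state j (s j) (env_history s \<omega> t) \<omega> t) \<in> borel_measurable N"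
          "(\<lambda>\<omega>. control j (s j) (env_history s \<omega> t) \<omega> t) \<in> borel_measurable N"
        using measurable_compose[OF pair measurable_state[OF s x0 w, OF that that]]
          measurable_compose[OF pair measurable_control[OF s x0 w, OF that that]] by simp_all
      show ?thesis
        unfolding contribution_def
        by (rule measurable_compose[OF _ borel_measurable_nth]) measurable
    qed
    have [measurable]: "(\<lambda>\<omega>. aggregate s (env_history s \<omega> t) \<omega> t k) \<in> borel_measurable N" for k
    proof -
      have [measurable]: "(\<lambda>\<omega>. if j = i then 0 else contribution s (env_history s \<omega> t) \<omega> t j $ k)
          \<in> borel_measurable N" for j
        using contr[of j k] by (cases "j = i") simp_all
      show ?thesis
        unfolding aggregate_drop[of s _ _ t k i] by measurable
    qed
    have [measurable]: "(\<lambda>\<omega>. (\<chi> k. real_of_ereal (aggregate s (env_history s \<omega> t) \<omega> t k)) :: real^'y) \<in> borel_measurable N"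
      by (subst borel_measurable_euclidean_space) (auto simp: Basis_vec_def inner_axis)
    show ?case
    proof (rule measurable_coordinatewise_then_product)
      fix r
      have "(\<lambda>\<omega>. env_history s \<omega> t r) \<in> borel_measurable N"
        by (rule measurable_compose[OF Suc.IH measurable_product_coordinates])
      then show "(\<lambda>\<omega>. env_history s \<omega> (Suc t) r) \<in> borel_measurable N"
        by (cases "r = t") simp_all
    qed
  qed
  have "(\<lambda>\<omega>. env s \<omega> t) \<in> borel_measurable N" for t
    unfolding env_def by (rule measurable_compose[OF hist measurable_product_coordinates])
  then show ?thesis by (rule measurable_coordinatewise_then_product)
qed

section \<open>Independence of the environment from one decision maker\<close>

lemma Int_stable_vimage: "Int_stable {f -` S \<inter> X |S. S \<in> sets N}"
proof (rule Int_stableI)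
  fix a b assume "a \<in> {f -` S \<inter> X |S. S \<in> sets N}" "b \<in> {f -` S \<inter> X |S. S \<in> sets N}"
  then obtain S T where "a = f -` S \<inter> X" "b = f -` T \<inter> X" "S \<in> sets N" "T \<in> sets N"
    by auto
  then have "a \<inter> b = f -` (S \<inter> T) \<inter> X" "S \<inter> T \<in> sets N"
    by auto
  then show "a \<inter> b \<in> {f -` S \<inter> X |S. S \<in> sets N}" by blast
qed

definition own_primitives :: "nat \<Rightarrow> primitive set" where
  "own_primitives i = insert (Init i) (range (Dist i))"

text \<open>The sigma-algebra generated by a set of primitive variables is encoded as a measurable space on
  the sample space. A random element that depends on these variables only is then a measurable map on
  it, and independence of sigma-algebras is independence of identity maps into such spaces.\<close>

definition primitive_algebra :: "primitive set \<Rightarrow> 'w measure" where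
  "primitive_algebra P = sigma (space M) (\<Union>p\<in>P. generated_events M x0 w \<xi> p)"

lemma generated_events_Pow: "generated_events M x0 w \<xi> p \<subseteq> Pow (space M)"
  by (cases p) auto

lemma Int_stable_generated_events: "Int_stable (generated_events M x0 w \<xi> p)"
  by (cases p) (simp_all add: Int_stable_vimage)

lemma space_primitive_algebra: "space (primitive_algebra P) = space M"
  unfolding primitive_algebra_def using generated_events_Pow by (intro space_measure_of) blast

lemma sets_primitive_algebra:
  "sets (primitive_algebra P) = sigma_sets (space M) (\<Union>p\<in>P. generated_events M x0 w \<xi> p)"
  unfolding primitive_algebra_def using generated_events_Pow by (intro sets_measure_of) blast

lemma measurable_primitive_algebra:
  shows "Init j \<in> P \<Longrightarrow> x0 j \<in> borel_measurable (primitive_algebra P)"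
    and "Dist j t \<in> P \<Longrightarrow> w j t \<in> borel_measurable (primitive_algebra P)"
    and "Noise t \<in> P \<Longrightarrow> \<xi> t \<in> borel_measurable (primitive_algebra P)"
  by (rule measurableI; force simp: sets_primitive_algebra space_primitive_algebra intro!: sigma_sets.Basic)+

lemma indep_primitive_algebras:
  assumes "prob_space M"
    and indep: "mutually_independent M x0 w \<xi>"
    and disj: "P \<inter> P' = {}"
  shows "prob_space.indep_var M (primitive_algebra P) (\<lambda>\<omega>. \<omega>) (primitive_algebra P') (\<lambda>\<omega>. \<omega>)"
proof -
  interpret prob_space M by fact
  let ?G = "generated_events M x0 w \<xi>"
  have ind: "indep_sets ?G UNIV"
    using indep by (simp add: mutually_independent_def)
  have "indep_sets (\<lambda>b. sigma_sets (space M) (\<Union>p\<in>case_bool P P' b. ?G p)) UNIV"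
  proof (rule indep_sets_collect_sigma)
    show "indep_sets ?G (\<Union>b. case_bool P P' b)"
      using ind by (rule indep_sets_mono_index[rotated]) simp
    show "disjoint_family_on (case_bool P P') UNIV"
      using disj by (auto simp: disjoint_family_on_def split: bool.splits)
  qed (rule Int_stable_generated_events)
  then have ind2: "indep_set (sets (primitive_algebra P)) (sets (primitive_algebra P'))"
    unfolding indep_set_def sets_primitive_algebra
    by (rule indep_sets_mono_sets) (auto split: bool.split)
  have sub: "sets (primitive_algebra P'') \<subseteq> sets M" for P''
    using ind unfolding sets_primitive_algebra
    by (intro sets.sigma_sets_subset) (auto simp: indep_sets_def)
  have vimage: "(\<lambda>\<omega>. \<omega>) -` S \<inter> space M = S" if "S \<in> sets (primitive_algebra P'')" for S P''
    using sets.sets_into_space[OF that] by (auto simp: space_primitive_algebra)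
  have id: "(\<lambda>\<omega>. \<omega>) \<in> M \<rightarrow>\<^sub>M primitive_algebra P''" for P''
    using sub by (intro measurableI) (auto simp: vimage space_primitive_algebra)
  have trace: "{(\<lambda>\<omega>. \<omega>) -` S \<inter> space M |S. S \<in> sets (primitive_algebra P'')} \<subseteq> sets (primitive_algebra P'')" for P''
    by (rule subsetI, elim CollectE exE conjE) (simp only: vimage)
  have generated: "sigma_sets (space M) {(\<lambda>\<omega>. \<omega>) -` S \<inter> space M |S. S \<in> sets (primitive_algebra P'')}
      \<subseteq> sets (primitive_algebra P'')" for P''
    using sets.sigma_sets_subset[OF trace] by (simp add: space_primitive_algebra)
  have "indep_set
      (sigma_sets (space M) {(\<lambda>\<omega>. \<omega>) -` S \<inter> space M |S. S \<in> sets (primitive_algebra P)})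
      (sigma_sets (space M) {(\<lambda>\<omega>. \<omega>) -` S \<inter> space M |S. S \<in> sets (primitive_algebra P')})"
    using ind2 unfolding indep_set_def
  proof (rule indep_sets_mono_sets)
    fix b
    show "case_bool (sigma_sets (space M) {(\<lambda>\<omega>. \<omega>) -` S \<inter> space M |S. S \<in> sets (primitive_algebra P)})
        (sigma_sets (space M) {(\<lambda>\<omega>. \<omega>) -` S \<inter> space M |S. S \<in> sets (primitive_algebra P')}) b
      \<subseteq> case_bool (sets (primitive_algebra P)) (sets (primitive_algebra P')) b"
      by (cases b) (simp_all only: bool.case generated)
  qed
  then show ?thesis
    using id by (simp add: indep_var_eq)
qed

text \<open>The primitive variables outside \<open>own_primitives i\<close> determine \<open>env s\<close>. The product law of the two
  complementary sigma-algebras is pushed forward by \<open>env s\<close> in the first factor.\<close>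

lemma joint_law_env_own:
  fixes i :: nat
  assumes "prob_space M"
    and indep: "mutually_independent M x0 w \<xi>"
    and s: "\<And>j. s j \<in> strategies"
  defines "Own \<equiv> primitive_algebra (own_primitives i)"
  shows "env s \<in> borel_measurable M" and "(\<lambda>\<omega>. \<omega>) \<in> M \<rightarrow>\<^sub>M Own"
    and "env_law s \<Otimes>\<^sub>M distr M Own (\<lambda>\<omega>. \<omega>) = distr M (borel \<Otimes>\<^sub>M Own) (\<lambda>\<omega>. (env s \<omega>, \<omega>))"
proof -
  interpret prob_space M by fact
  define Others where "Others = primitive_algebra (- own_primitives i)"
  have env[measurable]: "env s \<in> borel_measurable Others"
    unfolding Others_def
    by (rule measurable_env[OF s, of i])
       (auto simp: own_primitives_def intro!: measurable_primitive_algebra)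
  have "indep_var Others (\<lambda>\<omega>. \<omega>) Own (\<lambda>\<omega>. \<omega>)"
    unfolding Others_def Own_def by (intro indep_primitive_algebras assms) simp
  then have id_others[measurable]: "(\<lambda>\<omega>. \<omega>) \<in> M \<rightarrow>\<^sub>M Others" and own[measurable]: "(\<lambda>\<omega>. \<omega>) \<in> M \<rightarrow>\<^sub>M Own"
    and joint: "distr M Others (\<lambda>\<omega>. \<omega>) \<Otimes>\<^sub>M distr M Own (\<lambda>\<omega>. \<omega>) = distr M (Others \<Otimes>\<^sub>M Own) (\<lambda>\<omega>. (\<omega>, \<omega>))"
    by (simp_all add: indep_var_distribution_eq)
  show "env s \<in> borel_measurable M"
    using measurable_compose[OF id_others env] by simp
  show "(\<lambda>\<omega>. \<omega>) \<in> M \<rightarrow>\<^sub>M Own" by (rule own)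
  have "env_law s = distr (distr M Others (\<lambda>\<omega>. \<omega>)) borel (env s)"
    unfolding env_law_def by (simp add: distr_distr comp_def)
  moreover have "distr M Own (\<lambda>\<omega>. \<omega>) = distr (distr M Own (\<lambda>\<omega>. \<omega>)) Own (\<lambda>\<omega>. \<omega>)"
    by (simp add: distr_distr comp_def)
  ultimately have "env_law s \<Otimes>\<^sub>M distr M Own (\<lambda>\<omega>. \<omega>) =
      distr (distr M Others (\<lambda>\<omega>. \<omega>)) borel (env s) \<Otimes>\<^sub>M distr (distr M Own (\<lambda>\<omega>. \<omega>)) Own (\<lambda>\<omega>. \<omega>)"
    by simp
  also have "\<dots> = distr (distr M Others (\<lambda>\<omega>. \<omega>) \<Otimes>\<^sub>M distr M Own (\<lambda>\<omega>. \<omega>)) (borel \<Otimes>\<^sub>M Own) (\<lambda>(x, y). (env s x, y))"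
    by (intro pair_measure_distr prob_space_imp_sigma_finite prob_space.prob_space_distr prob_space_distr) simp_all
  also have "\<dots> = distr M (borel \<Otimes>\<^sub>M Own) (\<lambda>\<omega>. (env s \<omega>, \<omega>))"
    unfolding joint by (subst distr_distr) (simp_all add: comp_def)
  finally show "env_law s \<Otimes>\<^sub>M distr M Own (\<lambda>\<omega>. \<omega>) = distr M (borel \<Otimes>\<^sub>M Own) (\<lambda>\<omega>. (env s \<omega>, \<omega>))" .
qed

section \<open>The objective cost is the subjective cost\<close>

text \<open>By independence the joint law of \<open>env s\<close> and the primitive variables of decision maker \<open>i\<close> is the
  product of the belief \<open>env_law s\<close> with their own law, and the subjective cost is the iterated
  integral with respect to this product.\<close>

lemma objective_eq_subjective:
  assumes "prob_space M"
    and indep: "mutually_independent M x0 w \<xi>"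
    and s: "\<And>j. s j \<in> strategies"
    and \<sigma>: "\<sigma> \<in> strategies"
    and wd: "objective_cost_well_defined i (s(i := \<sigma>))"
  shows "objective_cost i (s(i := \<sigma>)) = expected_subjective_cost (env_law s) i \<sigma>"
proof -
  interpret prob_space M by fact
  define Own where "Own = primitive_algebra (own_primitives i)"
  define C where "C = (\<lambda>(z, \<omega>). \<Sum>t. discounted_stage_cost i \<sigma> z \<omega> t)"
  have [measurable]: "env s \<in> borel_measurable M" "(\<lambda>\<omega>. \<omega>) \<in> M \<rightarrow>\<^sub>M Own"
    and joint: "env_law s \<Otimes>\<^sub>M distr M Own (\<lambda>\<omega>. \<omega>) = distr M (borel \<Otimes>\<^sub>M Own) (\<lambda>\<omega>. (env s \<omega>, \<omega>))"
    unfolding Own_def by (rule joint_law_env_own[OF assms(1-3)])+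
  have C[measurable]: "C \<in> borel_measurable (borel \<Otimes>\<^sub>M Own)"
    unfolding C_def Own_def
    by (rule measurable_total_cost[OF \<sigma>])
       (rule measurable_primitive_algebra, simp add: own_primitives_def)+
  have "has_ereal_expectation M (\<lambda>\<omega>. C (env s \<omega>, \<omega>))"
    using wd by (simp add: objective_cost_well_defined_def env_deviation C_def)
  then have wd': "has_ereal_expectation (env_law s \<Otimes>\<^sub>M distr M Own (\<lambda>\<omega>. \<omega>)) C"
    unfolding joint by (simp add: has_ereal_expectation_def nn_integral_distr)
  have "objective_cost i (s(i := \<sigma>)) = ereal_expectation M (\<lambda>\<omega>. C (env s \<omega>, \<omega>))"
    by (simp add: objective_cost_def env_deviation C_def)
  also have "\<dots> = ereal_expectation (env_law s \<Otimes>\<^sub>M distr M Own (\<lambda>\<omega>. \<omega>)) C"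
    unfolding joint by (subst ereal_expectation_distr) simp_all
  also have "\<dots> = ereal_expectation (env_law s) (\<lambda>z. ereal_expectation (distr M Own (\<lambda>\<omega>. \<omega>)) (\<lambda>\<omega>. C (z, \<omega>)))"
    using wd' by (intro ereal_expectation_iterated[symmetric] prob_space_imp_sigma_finite prob_space_distr) simp_all
  also have "\<dots> = expected_subjective_cost (env_law s) i \<sigma>"
  proof -
    have "(\<lambda>\<omega>. C (z, \<omega>)) \<in> borel_measurable Own" for z
      by measurable
    then have "ereal_expectation (distr M Own (\<lambda>\<omega>. \<omega>)) (\<lambda>\<omega>. C (z, \<omega>)) = ereal_expectation M (\<lambda>\<omega>. C (z, \<omega>))" for z
      by (simp add: ereal_expectation_distr)
    then have "ereal_expectation (distr M Own (\<lambda>\<omega>. \<omega>)) (\<lambda>\<omega>. C (z, \<omega>)) = subjective_cost i \<sigma> z" for z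
      by (simp add: subjective_cost_def C_def)
    then show ?thesis by (simp add: expected_subjective_cost_def)
  qed
  finally show ?thesis .
qed

end

theorem mainTheorem5:
  fixes A :: "real^'x^'x" and B :: "real^'u^'x"
    and Q :: "real^'x^'x" and R :: "real^'u^'u"
    and K :: "real^'u^'y" and L :: "real^'x^'y"
    and E1 :: "real^'u^'y" and E2 :: "real^'x^'y"
    and \<beta> :: real
    and M :: "'w measure"
    and x0 :: "nat \<Rightarrow> 'w \<Rightarrow> real^'x"
    and w :: "nat \<Rightarrow> nat \<Rightarrow> 'w \<Rightarrow> real^'x"
    and \<xi> :: "nat \<Rightarrow> 'w \<Rightarrow> real^'y"
    and s :: "nat \<Rightarrow> ('x, 'u, 'y) strategy"
  assumes "prob_space M"
    and "positive_definite Q" and "positive_definite R"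
    and "0 \<le> \<beta>" and "\<beta> < 1"
    and "stabilizable A B"
    and "mutually_independent M x0 w \<xi>"
    and "\<And>i. finite_second_moment M (x0 i)"
    and "\<And>i t. finite_second_moment M (w i t)"
    and "\<And>t. finite_second_moment M (\<xi> t)"
    and "iid M x0" and "iid M (\<lambda>(i, t). w i t)" and "iid M \<xi>"
    and "lq_game.costs_well_defined A B Q R K L E1 E2 \<beta> M x0 w \<xi> s"
    and "lq_game.sebeu A B Q R K L E1 E2 \<beta> M x0 w \<xi> s"
  shows "lq_game.nash_equilibrium A B Q R K L E1 E2 \<beta> M x0 w \<xi> s"
proof -
  interpret lq_game A B Q R K L E1 E2 \<beta> M x0 w \<xi> .
  have s: "\<And>i. s i \<in> strategies" and fin: "env_finite s"
    using assms(15) by (auto simp: sebeu_def)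
  have opt: "expected_subjective_cost (env_law s) i (s i) \<le> expected_subjective_cost (env_law s) i \<sigma>"
      if "\<sigma> \<in> strategies" for i and \<sigma> :: "('x, 'u, 'y) strategy"
    using assms(15) that by (auto simp: sebeu_def)
  show ?thesis
    unfolding nash_equilibrium_def
  proof (intro conjI allI ballI s)
    fix i and \<sigma> :: "('x, 'u, 'y) strategy"
    assume \<sigma>: "\<sigma> \<in> strategies"
    show "env_finite (s(i := \<sigma>))"
      using fin by (simp add: env_finite_deviation)
    have obj: "objective_cost i (s(i := \<tau>)) = expected_subjective_cost (env_law s) i \<tau>"
      if "\<tau> \<in> strategies" for \<tau>
      using assms(14) that
      by (intro objective_eq_subjective assms(1,7) s) (auto simp: costs_well_defined_def)
    show "objective_cost i s \<le> objective_cost i (s(i := \<sigma>))"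
      using obj[OF s, of i] obj[OF \<sigma>] opt[OF \<sigma>, of i] by simp
  qed
qed

end
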